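(* Let $k,N\in\mathbb{N}$ with $k\ge 2$, $N\ge 1$, let $\xi_1,\dots,\xi_N\in[-1,1]$ and $\lambda_1,\dots,\lambda_N\ge 0$, and put $\mathcal{T}(f):=\sum_{i=1}^N\lambda_if(\xi_i)$ for $f:[-1,1]\to\mathbb{R}$. If $\mathcal{T}$ is exact on $\Pi_k$, then $$\bigl|\mathcal{I}(f)-\mathcal{T}(f)\bigr|\le\alpha_k\|f^{(k)}\|_\infty$$ for any $f\in\mathcal{C}^k([-1,1])$.
   Context: The constants are defined, for integers $n\ge 1$, by $$\alpha_{2n}:=\frac{4^{n+1}(n!)^4}{(2n+1)[(2n)!]^3},\qquad \alpha_{2n+1}:=\frac{4^{n+1}(n+1)(n!)^4}{[(2n+1)!]^3}.$$ $\Pi_m$ is the space of real polynomials of degree at most $m$. $\mathcal{I}(f):=\int_{-1}^1 f(x)\,dx$. $\mathcal{T}$ is exact on $\Pi_m$ if $\mathcal{T}(p)=\mathcal{I}(p)$ for all $p\in\Pi_m$. $\|g\|_\infty:=\sup\{|g(x)|: x\in[-1,1]\}$ for continuous $g$ on $[-1,1]$. *)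

theory Defs
  imports "HOL-Analysis.Analysis" "HOL-Computational_Algebra.Polynomial"
begin

definition alpha_even :: "nat \<Rightarrow> real" where
  "alpha_even n = 4 ^ (n + 1) * fact n ^ 4 / (real (2 * n + 1) * fact (2 * n) ^ 3)"

definition alpha_odd :: "nat \<Rightarrow> real" where
  "alpha_odd n = 4 ^ (n + 1) * real (n + 1) * fact n ^ 4 / fact (2 * n + 1) ^ 3"

text \<open>Only the values at \<open>k \<ge> 2\<close> are meaningful.\<close>

definition alpha :: "nat \<Rightarrow> real" where
  "alpha k = (if even k then alpha_even (k div 2) else alpha_odd (k div 2))"

definition I_int :: "(real \<Rightarrow> real) \<Rightarrow> real" where
  "I_int f = integral {-1..1} f"

definition quadrature :: "nat \<Rightarrow> (nat \<Rightarrow> real) \<Rightarrow> (nat \<Rightarrow> real) \<Rightarrow> (real \<Rightarrow> real) \<Rightarrow> real" where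
  "quadrature N w \<xi> f = (\<Sum>i = 1..N. w i * f (\<xi> i))"

definition exact_on_Pi :: "((real \<Rightarrow> real) \<Rightarrow> real) \<Rightarrow> nat \<Rightarrow> bool" where
  "exact_on_Pi T m \<longleftrightarrow> (\<forall>p :: real poly. degree p \<le> m \<longrightarrow> T (poly p) = I_int (poly p))"

text \<open>
  A function on \<open>[-1, 1]\<close> is represented by a total function whose values outside the
  interval are irrelevant. Derivatives are therefore taken within the interval, hence
  one-sided at its endpoints.
\<close>

definition nth_deriv :: "nat \<Rightarrow> (real \<Rightarrow> real) \<Rightarrow> real \<Rightarrow> real" where
  "nth_deriv n = (\<lambda>g x. vector_derivative g (at x within {-1..1})) ^^ n"

definition Ck_on :: "nat \<Rightarrow> (real \<Rightarrow> real) \<Rightarrow> bool" where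
  "Ck_on k f \<longleftrightarrow> (\<forall>j<k. nth_deriv j f differentiable_on {-1..1})
     \<and> continuous_on {-1..1} (nth_deriv k f)"

definition sup_norm :: "(real \<Rightarrow> real) \<Rightarrow> real" where
  "sup_norm g = (SUP x\<in>{-1..1}. \<bar>g x\<bar>)"

end

theory Submission
  imports Defs "HOL-Computational_Algebra.Fundamental_Theorem_Algebra"
begin

text \<open>
  Let \<open>M\<close> be the sup norm of the \<open>k\<close>-th derivative of \<open>f\<close> and let \<open>\<omega>\<close> be a monic polynomial of
  degree \<open>k\<close> that is nonnegative on \<open>[-1, 1]\<close> and has all its zeros there. The polynomial \<open>p\<close> that
  interpolates \<open>f\<close> at the zeros of \<open>\<omega>\<close>, with multiplicity, satisfies
  \<open>\<bar>f - p\<bar> \<le> M / k! \<cdot> \<omega>\<close> on \<open>[-1, 1]\<close> (\<open>interpolation_error_bound\<close>). Both the integral and the quadrature rule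
  are positive functionals, and they agree on \<open>p\<close> and on \<open>\<omega>\<close>. Applied to \<open>f - p\<close>, each of them
  is therefore at most \<open>M / k!\<close> times the integral of \<open>\<omega>\<close>, so the error of the rule is at most
  \<open>2 M / k!\<close> times that integral (\<open>quadrature_error_interpolation\<close>).

  It remains to choose \<open>\<omega>\<close> with a small integral. For \<open>k = 2 n + e\<close> with \<open>e \<in> {0, 1}\<close> the optimal choice is
  \<open>(1 + x)\<^sup>e Q(x)\<^sup>2\<close> with \<open>Q\<close> the monic orthogonal polynomial of degree \<open>n\<close> for the weight
  \<open>(1 + x)\<^sup>e\<close>: a Legendre polynomial, whose zeros are the Gauss nodes, or a Jacobi polynomial, whose
  zeros together with \<open>-1\<close> are the Radau nodes. Its integral is computed from the Rodrigues formula in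
  \<open>monic_jacobi\<close>, and it gives exactly the constant \<open>alpha k\<close> (\<open>alpha_eq\<close>).

  The zeros of \<open>\<omega>\<close> have to lie in \<open>[-1, 1]\<close>. This follows without locating those of \<open>Q\<close>: moving every
  complex zero of a monic polynomial to the nearest point of \<open>[-1, 1]\<close> does not increase its
  modulus on \<open>[-1, 1]\<close> (\<open>dominated_by_real_rooted\<close>), so after this change of \<open>Q\<close> the integral of
  \<open>\<omega>\<close> is at most what it was.
\<close>

section \<open>Polynomial interpolation with repeated nodes\<close>

text \<open>
  The difference quotient \<open>(F 0 x - F 0 a) / (x - a)\<close> extends over \<open>x = a\<close> as the average of \<open>F 1\<close> on
  the segment from \<open>a\<close> to \<open>x\<close>. Differentiating this average under the integral sign produces one
  factor \<open>t\<close> each time. So the quotient has one derivative less than \<open>F 0\<close>, and the factor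
  \<open>t\<^sup>k\<close> in the last derivative improves its bound by \<open>1 / (k + 1)\<close>; these gains build up the factorial
  in the interpolation error.
\<close>

lemma has_derivatives_slope:
  fixes F G :: "nat \<Rightarrow> real \<Rightarrow> real" and l u a :: real
  assumes G_def: "G = (\<lambda>j x. integral {0..1} (\<lambda>t. t ^ j * F (Suc j) (a + t * (x - a))))"
    and deriv: "\<forall>j\<le>k. \<forall>x\<in>{l..u}. (F j has_real_derivative F (Suc j) x) (at x within {l..u})"
    and cont: "continuous_on {l..u} (F (Suc k))"
    and a: "a \<in> {l..u}"
  shows "j < k \<Longrightarrow> x \<in> {l..u} \<Longrightarrow> (G j has_real_derivative G (Suc j) x) (at x within {l..u})"
    and "continuous_on {l..u} (G k)"
    and "x \<in> {l..u} \<Longrightarrow> F 0 x = F 0 a + (x - a) * G 0 x"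
    and "\<forall>y\<in>{l..u}. \<bar>F (Suc k) y\<bar> \<le> M \<Longrightarrow> x \<in> {l..u} \<Longrightarrow> \<bar>G k x\<bar> \<le> M / real (Suc k)"
proof -
  have seg: "a + t * (x - a) \<in> {l..u}" if "t \<in> {0..1}" "x \<in> {l..u}" for t x
    using convexD[of "{l..u}" a x "1 - t" t] that a by (simp add: algebra_simps)
  have contF: "continuous_on {l..u} (F j)" if "j \<le> Suc k" for j
  proof (cases "j = Suc k")
    case True
    then show ?thesis using cont by simp
  next
    case False
    with that have "j \<le> k" by simp
    then show ?thesis
      by (meson DERIV_continuous_on deriv)
  qed
  have cont2: "continuous_on ({l..u} \<times> {0..1}) (\<lambda>(x, t). t ^ j * F (Suc i) (a + t * (x - a)))"
    if "i \<le> k" for i j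
    unfolding case_prod_unfold
    by (intro continuous_intros continuous_on_compose2[OF contF[of "Suc i"]])
       (use that seg in auto)
  have contt: "continuous_on {0..1} (\<lambda>t. t ^ j * F (Suc i) (a + t * (x - a)))"
    if "i \<le> k" "x \<in> {l..u}" for i j x
    by (intro continuous_intros continuous_on_compose2[OF contF[of "Suc i"]])
       (use that seg in auto)
  show "(G j has_real_derivative G (Suc j) x) (at x within {l..u})"
    if j: "j < k" and x: "x \<in> {l..u}" for j x
  proof -
    have d: "((\<lambda>x. t ^ j * F (Suc j) (a + t * (x - a))) has_real_derivative
        t ^ Suc j * F (Suc (Suc j)) (a + t * (x - a))) (at x within {l..u})"
      if "x \<in> {l..u}" "t \<in> cbox 0 1" for x t
    proof -
      have "(F (Suc j) has_real_derivative F (Suc (Suc j)) (a + t * (x - a)))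
          (at (a + t * (x - a)) within (\<lambda>x. a + t * (x - a)) ` {l..u})"
        by (rule DERIV_subset[OF deriv[rule_format]]) (use j seg that in auto)
      then have "(F (Suc j) \<circ> (\<lambda>x. a + t * (x - a)) has_real_derivative
          F (Suc (Suc j)) (a + t * (x - a)) * t) (at x within {l..u})"
        by (rule DERIV_image_chain) (auto intro!: derivative_eq_intros)
      from DERIV_cmult[OF this, of "t ^ j"] show ?thesis
        by (simp add: o_def mult_ac)
    qed
    have "((\<lambda>x. integral (cbox 0 1) (\<lambda>t. t ^ j * F (Suc j) (a + t * (x - a)))) has_real_derivative
        integral (cbox 0 1) (\<lambda>t. t ^ Suc j * F (Suc (Suc j)) (a + t * (x - a)))) (at x within {l..u})"
    proof (rule leibniz_rule_field_derivative[OF d])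
      show "(\<lambda>t. t ^ j * F (Suc j) (a + t * (x - a))) integrable_on cbox 0 1"
        if "x \<in> {l..u}" for x
        using contt[of j x j] that j by (intro integrable_continuous) auto
      show "continuous_on ({l..u} \<times> cbox 0 1)
          (\<lambda>(x, t). t ^ Suc j * F (Suc (Suc j)) (a + t * (x - a)))"
        using cont2[of "Suc j" "Suc j"] j by simp
    qed (use x in auto)
    then show ?thesis unfolding G_def by simp
  qed
  show "continuous_on {l..u} (G k)"
    unfolding G_def
    using integral_continuous_on_param[of "{l..u}" 0 "1::real" "\<lambda>x t. t ^ k * F (Suc k) (a + t * (x - a))"]
      cont2[of k k] by simp
  show "F 0 x = F 0 a + (x - a) * G 0 x" if x: "x \<in> {l..u}" for x
  proof -
    have "((\<lambda>t. F (Suc 0) (a + t * (x - a)) * (x - a)) has_integral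
        F 0 (a + 1 * (x - a)) - F 0 (a + 0 * (x - a))) {0..1}"
    proof (rule fundamental_theorem_of_calculus)
      fix t :: real assume t: "t \<in> {0..1}"
      have "(F 0 has_real_derivative F (Suc 0) (a + t * (x - a)))
          (at (a + t * (x - a)) within (\<lambda>t. a + t * (x - a)) ` {0..1})"
        by (rule DERIV_subset[OF deriv[rule_format]]) (use seg x t in auto)
      then have "(F 0 \<circ> (\<lambda>t. a + t * (x - a)) has_real_derivative
          F (Suc 0) (a + t * (x - a)) * (x - a)) (at t within {0..1})"
        by (rule DERIV_image_chain) (auto intro!: derivative_eq_intros)
      then show "((\<lambda>t. F 0 (a + t * (x - a))) has_vector_derivative
          F (Suc 0) (a + t * (x - a)) * (x - a)) (at t within {0..1})"
        by (simp add: o_def has_real_derivative_iff_has_vector_derivative)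
    qed simp
    from integral_unique[OF this]
    have "F 0 x - F 0 a = integral {0..1} (\<lambda>t. F (Suc 0) (a + t * (x - a))) * (x - a)"
      by simp
    then show ?thesis by (simp add: G_def mult.commute)
  qed
  show "\<bar>G k x\<bar> \<le> M / real (Suc k)"
    if M: "\<forall>y\<in>{l..u}. \<bar>F (Suc k) y\<bar> \<le> M" and x: "x \<in> {l..u}" for x
  proof -
    have pow: "((\<lambda>t. t ^ k * M) has_integral M / real (Suc k)) {0..1}"
    proof -
      have "((\<lambda>t. t ^ k * M) has_integral 1 ^ Suc k * (M / real (Suc k)) - 0 ^ Suc k * (M / real (Suc k))) {0..1}"
        by (rule fundamental_theorem_of_calculus)
           (auto simp flip: has_real_derivative_iff_has_vector_derivative
             intro!: derivative_eq_intros simp del: power_Suc of_nat_Suc)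
      then show ?thesis by simp
    qed
    have "norm (G k x) \<le> integral {0..1} (\<lambda>t. t ^ k * M)"
      unfolding G_def
    proof (rule integral_norm_bound_integral)
      show "(\<lambda>t. t ^ k * F (Suc k) (a + t * (x - a))) integrable_on {0..1}"
        using contt[of k x k] x by (intro integrable_continuous_real) auto
      show "(\<lambda>t. t ^ k * M) integrable_on {0..1}" using pow by blast
      show "norm (t ^ k * F (Suc k) (a + t * (x - a))) \<le> t ^ k * M" if "t \<in> {0..1}" for t
        using M seg[OF that x] that by (simp add: abs_mult mult_left_mono)
    qed
    then show ?thesis by (simp only: integral_unique[OF pow] real_norm_def)
  qed
qed

text \<open>
  This is Newton interpolation with nodes of arbitrary multiplicity. One node \<open>a\<close> is split off by
  writing \<open>F 0 x = F 0 a + (x - a) G 0 x\<close> with the difference quotient \<open>G 0\<close>, which is then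
  interpolated at the remaining nodes. Since \<open>G 0\<close> is smooth across \<open>a\<close>, a repetition of \<open>a\<close>
  among them needs no separate treatment.
\<close>

lemma interpolation_error_bound:
  fixes F :: "nat \<Rightarrow> real \<Rightarrow> real"
  assumes "\<And>j x. j < length cs \<Longrightarrow> x \<in> {l..u} \<Longrightarrow>
      (F j has_real_derivative F (Suc j) x) (at x within {l..u})"
    and "continuous_on {l..u} (F (length cs))"
    and "set cs \<subseteq> {l..u}"
    and "\<And>x. x \<in> {l..u} \<Longrightarrow> \<bar>F (length cs) x\<bar> \<le> M"
  shows "\<exists>p :: real poly. degree p \<le> length cs \<and>
      (\<forall>x\<in>{l..u}. \<bar>F 0 x - poly p x\<bar> \<le> M / fact (length cs) * \<bar>\<Prod>c\<leftarrow>cs. x - c\<bar>)"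
  using assms
proof (induction cs arbitrary: F M)
  case Nil
  then show ?case by (intro exI[of _ 0]) auto
next
  case (Cons a cs)
  define k where "k = length cs"
  define G where "G = (\<lambda>j x. integral {0..1} (\<lambda>t. t ^ j * F (Suc j) (a + t * (x - a))))"
  have deriv: "\<forall>j\<le>k. \<forall>x\<in>{l..u}. (F j has_real_derivative F (Suc j) x) (at x within {l..u})"
    using Cons.prems(1) by (auto simp: k_def)
  have cont: "continuous_on {l..u} (F (Suc k))" and a: "a \<in> {l..u}"
    and bound: "\<forall>y\<in>{l..u}. \<bar>F (Suc k) y\<bar> \<le> M"
    using Cons.prems by (auto simp: k_def)
  note slope = has_derivatives_slope[OF G_def deriv cont a]
  obtain q where q: "degree q \<le> k"
    "\<forall>x\<in>{l..u}. \<bar>G 0 x - poly q x\<bar> \<le> (M / real (Suc k)) / fact k * \<bar>\<Prod>c\<leftarrow>cs. x - c\<bar>"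
    using Cons.IH[of G "M / real (Suc k)", folded k_def] slope(1,2) slope(4)[OF bound] Cons.prems(3)
    by auto
  show ?case
  proof (intro exI[of _ "[:F 0 a:] + [:-a, 1:] * q"] conjI ballI)
    have "degree ([:-a, 1:] * q) \<le> Suc k"
      using degree_mult_le[of "[:-a, 1:]" q] q(1) by simp
    then show "degree ([:F 0 a:] + [:-a, 1:] * q) \<le> length (a # cs)"
      by (intro degree_add_le) (auto simp: k_def)
    fix x assume x: "x \<in> {l..u}"
    have "\<bar>F 0 x - poly ([:F 0 a:] + [:-a, 1:] * q) x\<bar> = \<bar>x - a\<bar> * \<bar>G 0 x - poly q x\<bar>"
      using slope(3)[OF x] by (simp flip: abs_mult add: algebra_simps)
    also have "\<dots> \<le> \<bar>x - a\<bar> * ((M / real (Suc k)) / fact k * \<bar>\<Prod>c\<leftarrow>cs. x - c\<bar>)"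
      using q(2) x by (intro mult_left_mono) auto
    also have "\<dots> = M / fact (length (a # cs)) * \<bar>\<Prod>c\<leftarrow>a # cs. x - c\<bar>"
      by (simp add: k_def abs_mult mult_ac)
    finally show "\<bar>F 0 x - poly ([:F 0 a:] + [:-a, 1:] * q) x\<bar>
        \<le> M / fact (length (a # cs)) * \<bar>\<Prod>c\<leftarrow>a # cs. x - c\<bar>" .
  qed
qed

section \<open>Monic Jacobi polynomials and their norm\<close>

lemma integral_poly_by_parts:
  fixes p q :: "real poly"
  assumes "l \<le> u" "poly (p * q) l = 0" "poly (p * q) u = 0"
  shows "integral {l..u} (poly (pderiv p * q)) = - integral {l..u} (poly (p * pderiv q))"
proof -
  have "(poly (pderiv (p * q)) has_integral poly (p * q) u - poly (p * q) l) {l..u}"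
    using assms(1)
    by (intro fundamental_theorem_of_calculus)
       (simp_all only: has_field_derivative_at_within[OF poly_DERIV]
         flip: has_real_derivative_iff_has_vector_derivative)
  then have "0 = integral {l..u} (poly (pderiv (p * q)))"
    by (simp only: integral_unique assms)
  also have "poly (pderiv (p * q)) = (\<lambda>x. poly (pderiv p * q) x + poly (p * pderiv q) x)"
    by (simp add: fun_eq_iff pderiv_mult)
  also have "integral {l..u} \<dots> = integral {l..u} (poly (pderiv p * q)) + integral {l..u} (poly (p * pderiv q))"
    by (intro integral_add integrable_continuous_real continuous_intros)
  finally show ?thesis by simp
qed

lemma power_dvd_higher_pderiv:
  fixes p :: "real poly"
  shows "[:-c, 1:] ^ (m + j) dvd p \<Longrightarrow> [:-c, 1:] ^ m dvd (pderiv ^^ j) p"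
proof (induction j arbitrary: m)
  case (Suc j)
  then have "[:-c, 1:] ^ Suc m dvd (pderiv ^^ j) p"
    by (metis add_Suc_shift)
  then obtain r where "(pderiv ^^ j) p = [:-c, 1:] ^ Suc m * r" by blast
  moreover have "pderiv (L ^ Suc m * r) = L ^ m * (L * pderiv r + smult (of_nat (Suc m)) r)"
    if "pderiv L = 1" for L
    by (subst pderiv_mult, subst pderiv_power_Suc) (simp add: that algebra_simps)
  ultimately have "(pderiv ^^ Suc j) p =
      [:-c, 1:] ^ m * ([:-c, 1:] * pderiv r + smult (of_nat (Suc m)) r)"
    by (simp add: pderiv_pCons del: power_Suc of_nat_Suc mult_pCons_left)
  then show ?case by (metis dvd_triv_left)
qed auto

text \<open>
  The zeros of order \<open>n\<close> at both endpoints remove the boundary terms of all \<open>n\<close> integrations by parts.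
\<close>

lemma integral_higher_pderiv:
  fixes p q :: "real poly"
  assumes "l \<le> u" "[:-l, 1:] ^ n dvd p" "[:-u, 1:] ^ n dvd p"
  shows "integral {l..u} (poly ((pderiv ^^ n) p * q)) =
      (-1) ^ n * integral {l..u} (poly (p * (pderiv ^^ n) q))"
  using assms
proof (induction n arbitrary: q)
  case (Suc n)
  have zero: "poly ((pderiv ^^ n) p) c = 0" if "[:-c, 1:] ^ Suc n dvd p" for c
    using power_dvd_higher_pderiv[of c 1 n p] that by (simp add: poly_eq_0_iff_dvd)
  have dvd: "[:-l, 1:] ^ n dvd p" "[:-u, 1:] ^ n dvd p"
    using Suc.prems(2,3) by (meson dvd_trans le_imp_power_dvd lessI less_imp_le)+
  have "integral {l..u} (poly ((pderiv ^^ Suc n) p * q)) =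
      - integral {l..u} (poly ((pderiv ^^ n) p * pderiv q))"
    using integral_poly_by_parts[of l u "(pderiv ^^ n) p" q] zero Suc.prems by simp
  also have "\<dots> = (-1) ^ Suc n * integral {l..u} (poly (p * (pderiv ^^ n) (pderiv q)))"
    using Suc.IH[of "pderiv q"] Suc.prems(1) dvd by (simp del: poly_mult)
  finally show ?case by (simp add: funpow_swap1 del: poly_mult)
qed auto

lemma integral_beta:
  "integral {-1..1} (poly ([:1, -1:] ^ a * [:1, 1:] ^ b)) =
     (2 ^ (a + b + 1) * fact a * fact b / fact (a + b + 1) :: real)"
proof (induction a arbitrary: b)
  case 0
  have "(poly ([:1, 1:] ^ b) has_integral
      (1 + 1) ^ Suc b / real (Suc b) - (1 + (-1)) ^ Suc b / real (Suc b)) {-1..1}"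
    by (rule fundamental_theorem_of_calculus)
       (auto simp flip: has_real_derivative_iff_has_vector_derivative simp: poly_power
         intro!: derivative_eq_intros simp del: power_Suc of_nat_Suc)
  from integral_unique[OF this] show ?case
    unfolding power_0 mult_1 by (simp only:) simp
next
  case (Suc a)
  have d1: "pderiv ([:1, -1:] ^ Suc a) = smult (- real (Suc a)) ([:1, -1:] ^ a)"
    and d2: "pderiv ([:1, 1:] ^ Suc b) = smult (real (Suc b)) ([:1, 1:] ^ b)"
    by (simp_all add: pderiv_power_Suc pderiv_pCons one_pCons del: power_Suc of_nat_Suc)
  have int_smult: "integral {-1..1} (poly (smult c p)) = c * integral {-1..1} (poly p)"
    for c :: real and p
  proof -
    have "poly (smult c p) = (\<lambda>x. c * poly p x)" by auto
    then show ?thesis by simp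
  qed
  have "integral {-1..1} (poly (pderiv ([:1, 1:] ^ Suc b) * [:1, -1:] ^ Suc a)) =
      (- integral {-1..1} (poly ([:1, 1:] ^ Suc b * pderiv ([:1, -1:] ^ Suc a))) :: real)"
    by (rule integral_poly_by_parts) auto
  then have "real (Suc b) * integral {-1..1} (poly ([:1, -1:] ^ Suc a * [:1, 1:] ^ b)) =
      real (Suc a) * integral {-1..1} (poly ([:1, -1:] ^ a * [:1, 1:] ^ Suc b))"
    unfolding d1 d2 mult_smult_left mult_smult_right int_smult by (simp add: mult.commute del: power_Suc of_nat_Suc poly_mult)
  also have "\<dots> = real (Suc a) * (2 ^ (a + Suc b + 1) * fact a * fact (Suc b) / fact (a + Suc b + 1))"
    by (simp only: Suc.IH)
  also have "\<dots> = real (Suc b) * (2 ^ (Suc a + b + 1) * fact (Suc a) * fact b / fact (Suc a + b + 1))"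
    by simp
  finally show ?case
    by (rule mult_left_cancel[THEN iffD1, rotated]) simp
qed

text \<open>
  By the Rodrigues formula, \<open>Q\<close> is a multiple of \<open>(1 + x)\<^sup>-\<^sup>e\<close> times the \<open>n\<close>-th derivative of
  \<open>W = (x - 1)\<^sup>n (x + 1)\<^sup>n\<^sup>+\<^sup>e\<close>. In the weighted integral of \<open>Q\<^sup>2\<close> the weight cancels one of the
  factors \<open>(1 + x)\<^sup>-\<^sup>e\<close>; integrating by parts \<open>n\<close> times then moves all derivatives from \<open>W\<close> to
  the other factor \<open>Q\<close>, where they leave the constant \<open>n!\<close>, and a beta integral remains.
\<close>

lemma monic_jacobi:
  "\<exists>Q :: real poly. degree Q = n \<and> lead_coeff Q = 1 \<and>
     integral {-1..1} (\<lambda>x. (1 + x) ^ e * poly Q x ^ 2) =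
       2 ^ (2 * n + e + 1) * fact n ^ 2 * fact (n + e) ^ 2 / (fact (2 * n + e) * fact (2 * n + e + 1))"
proof -
  define W :: "real poly" where "W = [:-1, 1:] ^ n * [:1, 1:] ^ (n + e)"
  have "degree W = 2 * n + e"
    by (simp add: W_def degree_mult_eq degree_power_eq)
  moreover have "lead_coeff W = 1"
    by (simp only: W_def lead_coeff_mult lead_coeff_power) simp
  ultimately have W: "degree W = 2 * n + e" "coeff W (2 * n + e) = 1" by simp_all
  have "[:1, 1:] ^ e dvd (pderiv ^^ n) W"
    using power_dvd_higher_pderiv[of "-1" e n W] by (simp add: W_def add.commute)
  then obtain R where R: "(pderiv ^^ n) W = [:1, 1:] ^ e * R" by blast
  \<comment> \<open>the leading coefficient of \<open>R\<close>, produced by differentiating \<open>x\<^bsup>2 n + e\<^esup>\<close> \<open>n\<close> times\<close>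
  define c :: real where "c = fact (2 * n + e) / fact (n + e)"
  have c: "c > 0" by (simp add: c_def)
  have lcD: "coeff ((pderiv ^^ n) W) (n + e) = c"
  proof -
    have "n + e + n = 2 * n + e" by simp
    then have "coeff W (n + e + n) = 1" using W(2) by (simp only:)
    moreover have "pochhammer (real (Suc (n + e))) n = c"
      using pochhammer_product[of "n + e" "2 * n + e" "1 :: real"]
      by (simp add: c_def pochhammer_fact[symmetric] field_simps)
    ultimately show ?thesis by (simp add: coeff_higher_pderiv)
  qed
  have degD: "degree ((pderiv ^^ n) W) = n + e"
    by (simp add: degree_higher_pderiv W)
  have Rnz: "R \<noteq> 0" using R lcD c by auto
  have degR: "degree R = n"
    using degD Rnz unfolding R by (simp add: degree_mult_eq degree_power_eq)
  have lcR: "lead_coeff R = c"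
    using lcD[folded degD] unfolding R by (simp add: lead_coeff_mult lead_coeff_power)
  have dR: "(pderiv ^^ n) R = [:fact n * c:]"
  proof (rule poly_eqI)
    fix i
    show "coeff ((pderiv ^^ n) R) i = coeff [:fact n * c:] i"
    proof (cases i)
      case 0
      then show ?thesis using lcR degR by (simp add: coeff_higher_pderiv pochhammer_fact)
    next
      case (Suc j)
      then show ?thesis using degR by (simp add: coeff_higher_pderiv coeff_eq_0)
    qed
  qed
  have "integral {-1..1} (poly ([:1, 1:] ^ e * R * R)) =
      (-1) ^ n * integral {-1..1} (poly (W * (pderiv ^^ n) R))"
    unfolding R[symmetric]
    by (rule integral_higher_pderiv) (auto simp: W_def power_add dvd_mult)
  also have "poly (W * (pderiv ^^ n) R) =
      (\<lambda>x. ((-1) ^ n * fact n * c) * poly ([:1, -1:] ^ n * [:1, 1:] ^ (n + e)) x)"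
  proof
    fix x :: real
    have "(x - 1) ^ n = (-1) ^ n * (1 - x) ^ n"
      by (simp flip: power_mult_distrib)
    then show "poly (W * (pderiv ^^ n) R) x =
        ((-1) ^ n * fact n * c) * poly ([:1, -1:] ^ n * [:1, 1:] ^ (n + e)) x"
      unfolding dR by (simp add: W_def poly_power algebra_simps)
  qed
  finally have norm: "integral {-1..1} (poly ([:1, 1:] ^ e * R * R)) =
      fact n * c * (2 ^ (n + (n + e) + 1) * fact n * fact (n + e) / fact (n + (n + e) + 1))"
    by (simp only: integral_mult_right integral_beta) (simp flip: power_mult_distrib)
  have "integral {-1..1} (\<lambda>x. (1 + x) ^ e * poly (smult (1 / c) R) x ^ 2) =
      integral {-1..1} (\<lambda>x. (1 / c) ^ 2 * poly ([:1, 1:] ^ e * R * R) x)"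
    by (simp add: poly_power power2_eq_square mult_ac)
  also have "\<dots> = (1 / c) ^ 2 *
      (fact n * c * (2 ^ (n + (n + e) + 1) * fact n * fact (n + e) / fact (n + (n + e) + 1)))"
    by (simp only: integral_mult_right norm)
  also have "\<dots> = 2 ^ (2 * n + e + 1) * fact n ^ 2 * fact (n + e) ^ 2 /
      (fact (2 * n + e) * fact (2 * n + e + 1))"
  proof -
    have "n + (n + e) + 1 = 2 * n + e + 1" by simp
    then show ?thesis
      by (simp only:) (simp add: c_def power2_eq_square field_simps del: fact_Suc power_Suc)
  qed
  finally show ?thesis
    using c degR lcR by (intro exI[of _ "smult (1 / c) R"]) auto
qed

section \<open>Moving the zeros of a polynomial into an interval\<close>

text \<open>
  For \<open>x\<close> in the interval, the distance from \<open>x\<close> to a complex zero \<open>z\<close> does not increase when \<open>z\<close>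
  is replaced by its real part and the real part is then clamped to the interval: both are
  projections onto convex sets that contain \<open>x\<close>.
\<close>

lemma dominated_by_real_rooted:
  fixes Q :: "real poly"
  assumes "lead_coeff Q = 1" "l \<le> u"
  shows "\<exists>cs. length cs = degree Q \<and> set cs \<subseteq> {l..u} \<and>
      (\<forall>x\<in>{l..u}. \<bar>\<Prod>c\<leftarrow>cs. x - c\<bar> \<le> \<bar>poly Q x\<bar>)"
proof -
  define P :: "complex poly" where "P = map_poly of_real Q"
  have P: "P \<noteq> 0" "lead_coeff P = 1" "degree P = degree Q"
    using assms(1) by (auto simp: P_def coeff_map_poly degree_map_poly map_poly_eq_0_iff)
  obtain A where A: "size A = degree P" "P = (\<Prod>z\<in>#A. [:-z, 1:])"
    using alg_closed_imp_factorization[OF P(1)] P(2) by auto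
  obtain zs where zs: "mset zs = A" using ex_mset by blast
  have len: "length zs = degree Q" using A(1) P(3) by (simp flip: zs)
  have eval: "complex_of_real (poly Q x) = (\<Prod>z\<leftarrow>zs. of_real x - z)" for x
  proof -
    have "complex_of_real (poly Q x) = poly P (of_real x)"
      unfolding P_def by (induction Q) (simp_all add: map_poly_pCons)
    also have "P = (\<Prod>z\<leftarrow>zs. [:-z, 1:])"
      unfolding A(2) zs[symmetric] by (simp flip: mset_map prod_mset_prod_list)
    also have "poly \<dots> (of_real x) = (\<Prod>z\<leftarrow>zs. of_real x - z)"
      by (induction zs) (auto simp: algebra_simps)
    finally show ?thesis .
  qed
  define clamp where "clamp = (\<lambda>z. max l (min u (Re z)))"
  have near: "\<bar>x - clamp z\<bar> \<le> norm (of_real x - z)" if "x \<in> {l..u}" for x z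
  proof -
    have "\<bar>x - clamp z\<bar> \<le> \<bar>Re (of_real x - z)\<bar>"
      using that by (auto simp: clamp_def)
    also have "\<dots> \<le> norm (of_real x - z)" by (rule abs_Re_le_cmod)
    finally show ?thesis .
  qed
  have "\<bar>\<Prod>c\<leftarrow>map clamp zs. x - c\<bar> \<le> \<bar>poly Q x\<bar>" if "x \<in> {l..u}" for x
  proof -
    have "\<bar>\<Prod>c\<leftarrow>map clamp zs. x - c\<bar> \<le> norm (\<Prod>z\<leftarrow>zs. of_real x - z)"
      by (induction zs) (auto simp: abs_mult norm_mult intro!: mult_mono near[OF that])
    also have "\<dots> = \<bar>poly Q x\<bar>"
      by (metis eval norm_of_real real_norm_def)
    finally show ?thesis .
  qed
  then show ?thesis
    using len assms(2) by (intro exI[of _ "map clamp zs"]) (auto simp: clamp_def)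
qed

section \<open>The error of a positive quadrature rule\<close>

text \<open>
  Since the exactness degree is the number of interpolation nodes, the rule is exact on the nodal
  polynomial as well as on the interpolant. This is what bounds the rule applied to the
  interpolation error, whatever the quadrature nodes are.
\<close>

lemma quadrature_error_interpolation:
  fixes F :: "nat \<Rightarrow> real \<Rightarrow> real"
  assumes nodes: "\<And>i. i \<in> {1..N} \<Longrightarrow> \<xi> i \<in> {-1..1}"
    and weights: "\<And>i. i \<in> {1..N} \<Longrightarrow> w i \<ge> 0"
    and exact: "exact_on_Pi (quadrature N w \<xi>) (length cs)"
    and deriv: "\<And>j x. j < length cs \<Longrightarrow> x \<in> {-1..1} \<Longrightarrow>
      (F j has_real_derivative F (Suc j) x) (at x within {-1..1})"
    and cont: "continuous_on {-1..1} (F 0)" "continuous_on {-1..1} (F (length cs))"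
    and cs: "set cs \<subseteq> {-1..1}"
    and nonneg: "\<And>x. x \<in> {-1..1} \<Longrightarrow> 0 \<le> (\<Prod>c\<leftarrow>cs. x - c)"
    and bound: "\<And>x. x \<in> {-1..1} \<Longrightarrow> \<bar>F (length cs) x\<bar> \<le> M"
  shows "\<bar>I_int (F 0) - quadrature N w \<xi> (F 0)\<bar> \<le>
    2 * M / fact (length cs) * integral {-1..1} (\<lambda>x. \<Prod>c\<leftarrow>cs. x - c)"
proof -
  define C where "C = M / fact (length cs)"
  define om :: "real poly" where "om = (\<Prod>c\<leftarrow>cs. [:-c, 1:])"
  have om: "poly om x = (\<Prod>c\<leftarrow>cs. x - c)" for x
    unfolding om_def by (induction cs) (auto simp: algebra_simps)
  have degom: "degree om \<le> length cs"
    unfolding om_def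
  proof (induction cs)
    case (Cons c cs)
    then show ?case
      using degree_mult_le[of "[:-c, 1:]" "\<Prod>c\<leftarrow>cs. [:-c, 1:]"] by simp
  qed auto
  obtain p where p: "degree p \<le> length cs"
    and "\<forall>x\<in>{-1..1}. \<bar>F 0 x - poly p x\<bar> \<le> C * \<bar>\<Prod>c\<leftarrow>cs. x - c\<bar>"
    using interpolation_error_bound[of cs "-1" 1 F M] deriv cont cs bound
    unfolding C_def by blast
  then have diff: "\<bar>F 0 x - poly p x\<bar> \<le> C * poly om x" if "x \<in> {-1..1}" for x
    using that nonneg by (simp add: om)
  have "\<bar>I_int (F 0) - I_int (poly p)\<bar> = norm (integral {-1..1} (\<lambda>x. F 0 x - poly p x))"
    unfolding I_int_def real_norm_def
    by (subst integral_diff) (auto intro!: integrable_continuous_real continuous_intros cont)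
  also have "\<dots> \<le> integral {-1..1} (\<lambda>x. C * poly om x)"
    by (rule integral_norm_bound_integral)
       (auto intro!: integrable_continuous_real continuous_intros cont diff)
  also have "\<dots> = C * I_int (poly om)"
    by (simp add: I_int_def)
  finally have I: "\<bar>I_int (F 0) - I_int (poly p)\<bar> \<le> C * I_int (poly om)" .
  have "quadrature N w \<xi> (F 0) - quadrature N w \<xi> (poly p) =
      (\<Sum>i = 1..N. w i * (F 0 (\<xi> i) - poly p (\<xi> i)))"
    by (simp add: quadrature_def sum_subtractf right_diff_distrib)
  also have "\<bar>\<dots>\<bar> \<le> (\<Sum>i = 1..N. w i * (C * poly om (\<xi> i)))"
    using nodes weights diff
    by (intro order_trans[OF sum_abs] sum_mono) (auto simp: abs_mult intro!: mult_left_mono)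
  also have "\<dots> = C * quadrature N w \<xi> (poly om)"
    by (simp add: quadrature_def sum_distrib_left mult_ac)
  finally have T: "\<bar>quadrature N w \<xi> (F 0) - quadrature N w \<xi> (poly p)\<bar> \<le> C * quadrature N w \<xi> (poly om)" .
  have "quadrature N w \<xi> (poly p) = I_int (poly p)" "quadrature N w \<xi> (poly om) = I_int (poly om)"
    using exact p degom by (auto simp: exact_on_Pi_def)
  then have "\<bar>quadrature N w \<xi> (F 0) - I_int (poly p)\<bar> \<le> C * I_int (poly om)"
    using T by simp
  then have "\<bar>I_int (F 0) - quadrature N w \<xi> (F 0)\<bar> \<le> 2 * (C * I_int (poly om))"
    using I by linarith
  moreover have "poly om = (\<lambda>x. \<Prod>c\<leftarrow>cs. x - c)"
    by (simp add: fun_eq_iff om)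
  ultimately show ?thesis
    by (simp add: C_def I_int_def)
qed

lemma alpha_eq:
  "alpha (2 * n + e) = 2 / fact (2 * n + e) *
     (2 ^ (2 * n + e + 1) * fact n ^ 2 * fact (n + e) ^ 2 / (fact (2 * n + e) * fact (2 * n + e + 1)))"
  if "e < 2"
proof -
  have p4: "(4::real) ^ n = 2 ^ (2 * n)" by (simp add: power_mult)
  from that consider "e = 0" | "e = 1" by linarith
  then show ?thesis
  proof cases
    case 1
    then show ?thesis
      by (simp add: alpha_def alpha_even_def p4 power2_eq_square power3_eq_cube power4_eq_xxxx field_simps)
  next
    case 2
    have nz: "2 * real n + 2 \<noteq> 0" by linarith
    have fs: "fact (2 * n + 1 + 1) = (2 * real n + 2) * fact (2 * n + 1)"
      "fact (n + 1) = (real n + 1) * (fact n :: real)"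
      by simp_all
    have "2 / A * (2 ^ (2 * n + 1 + 1) * B ^ 2 * ((real n + 1) * B) ^ 2 / (A * ((2 * real n + 2) * A)))
        = 4 ^ (n + 1) * real (n + 1) * B ^ 4 / A ^ 3" if "A > 0" for A B :: real
      using that nz
      by (simp add: p4 power2_eq_square power3_eq_cube power4_eq_xxxx divide_simps) (simp add: algebra_simps)
    from this[of "fact (2 * n + 1)" "fact n"]
    have "alpha_odd n = 2 / fact (2 * n + 1) * (2 ^ (2 * n + 1 + 1) * fact n ^ 2 * fact (n + 1) ^ 2 /
        (fact (2 * n + 1) * fact (2 * n + 1 + 1)))"
      unfolding alpha_odd_def fs by (metis fact_gt_zero)
    moreover have "alpha (2 * n + 1) = alpha_odd n" by (simp add: alpha_def)
    ultimately show ?thesis unfolding 2 by (simp only:)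
  qed
qed

theorem corollary22:
  fixes k N :: nat and \<xi> w :: "nat \<Rightarrow> real" and f :: "real \<Rightarrow> real"
  assumes "k \<ge> 2" and "N \<ge> 1"
    and "\<And>i. i \<in> {1..N} \<Longrightarrow> \<xi> i \<in> {-1..1}"
    and "\<And>i. i \<in> {1..N} \<Longrightarrow> w i \<ge> 0"
    and "exact_on_Pi (quadrature N w \<xi>) k"
    and "Ck_on k f"
  shows "\<bar>I_int f - quadrature N w \<xi> f\<bar> \<le> alpha k * sup_norm (nth_deriv k f)"
proof -
  define F where "F = (\<lambda>j. nth_deriv j f)"
  define M where "M = sup_norm (F k)"
  have F0: "F 0 = f" by (simp add: F_def nth_deriv_def)
  have deriv: "(F j has_real_derivative F (Suc j) x) (at x within {-1..1})"
    if "j < k" "x \<in> {-1..1}" for j x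
    using assms(6) that
    by (auto simp: Ck_on_def F_def nth_deriv_def differentiable_on_def
        has_real_derivative_iff_has_vector_derivative vector_derivative_works)
  have contk: "continuous_on {-1..1} (F k)"
    using assms(6) by (simp add: Ck_on_def F_def)
  have cont0: "continuous_on {-1..1} (F 0)"
    using assms(1) by (intro DERIV_continuous_on[OF deriv]) auto
  have bound: "\<bar>F k x\<bar> \<le> M" if "x \<in> {-1..1}" for x
  proof -
    have "bounded ((\<lambda>x. \<bar>F k x\<bar>) ` {-1..1})"
      by (intro compact_imp_bounded compact_continuous_image continuous_intros contk) auto
    then show ?thesis
      unfolding M_def sup_norm_def using that by (intro cSUP_upper bounded_imp_bdd_above) auto
  qed
  have M0: "M \<ge> 0" using bound[of 0] by auto
  define n e where "n = k div 2" and "e = k mod 2"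
  have k: "k = 2 * n + e" and e: "e < 2" by (simp_all add: n_def e_def)
  obtain Q :: "real poly" where Q: "degree Q = n" "lead_coeff Q = 1"
    "integral {-1..1} (\<lambda>x. (1 + x) ^ e * poly Q x ^ 2) =
       2 ^ (2 * n + e + 1) * fact n ^ 2 * fact (n + e) ^ 2 / (fact (2 * n + e) * fact (2 * n + e + 1))"
    using monic_jacobi by blast
  obtain cs where cs: "length cs = n" "set cs \<subseteq> {-1..1}"
    "\<And>x. x \<in> {-1..1} \<Longrightarrow> \<bar>\<Prod>c\<leftarrow>cs. x - c\<bar> \<le> \<bar>poly Q x\<bar>"
    using dominated_by_real_rooted[OF Q(2), of "-1" 1] Q(1) by auto
  \<comment> \<open>For odd \<open>k\<close> the simple node \<open>-1\<close> completes the double nodes to the right number; the factor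
    \<open>1 + x\<close> that it contributes is nonnegative on the interval.\<close>
  define ds where "ds = replicate e (-1) @ cs @ cs"
  have len: "length ds = k" by (simp add: ds_def cs k)
  have prod: "(\<Prod>c\<leftarrow>ds. x - c) = (1 + x) ^ e * (\<Prod>c\<leftarrow>cs. x - c) ^ 2" for x
    by (simp add: ds_def power2_eq_square add.commute prod_list_replicate map_replicate)
  have "\<bar>I_int (F 0) - quadrature N w \<xi> (F 0)\<bar> \<le>
      2 * M / fact (length ds) * integral {-1..1} (\<lambda>x. \<Prod>c\<leftarrow>ds. x - c)"
  proof (rule quadrature_error_interpolation)
    show "set ds \<subseteq> {-1..1}" using cs(2) by (auto simp: ds_def)
    show "0 \<le> (\<Prod>c\<leftarrow>ds. x - c)" if "x \<in> {-1..1}" for x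
      unfolding prod using that by simp
  qed (use assms deriv cont0 contk bound in \<open>auto simp: len\<close>)
  also have "\<dots> \<le> 2 * M / fact k * integral {-1..1} (\<lambda>x. (1 + x) ^ e * poly Q x ^ 2)"
    unfolding len
  proof (intro mult_left_mono integral_le)
    have "continuous_on {-1..1} (\<lambda>x. \<Prod>c\<leftarrow>cs. x - c)"
      by (induction cs) (auto intro!: continuous_intros)
    then show "(\<lambda>x. \<Prod>c\<leftarrow>ds. x - c) integrable_on {-1..1}"
      unfolding prod by (intro integrable_continuous_real continuous_intros)
    show "(\<Prod>c\<leftarrow>ds. x - c) \<le> (1 + x) ^ e * poly Q x ^ 2" if "x \<in> {-1..1}" for x
      unfolding prod using that cs(3)[OF that]
      by (intro mult_left_mono) (auto simp: abs_le_square_iff)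
  qed (auto intro!: integrable_continuous_real continuous_intros simp: M0)
  also have "\<dots> = alpha k * M"
    unfolding Q(3) k using alpha_eq[of e n] e by simp
  finally show ?thesis by (simp only: F0) (simp add: M_def F_def)
qed

end
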